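(* For $c\in\mathbb{R}$ let $A_n(c):=\{\theta\in\Theta:\ \|\theta-\theta_0\|\le c/\sqrt n\}$. Let $T_n=T_n(\mathbf{Y}_n)$ be a real-valued test statistic, and let $G_n(t\mid\theta)=P_\theta^n(T_n\le t)$ denote its CDF under $P_\theta^n$. Suppose that: (P1) for every $\epsilon>0$ there exist $c_\epsilon$ and $N_\epsilon>0$ such that for all $n>N_\epsilon$, $$P_{\theta_0}^n\big(\pi(A_n(c_\epsilon)\mid \mathbf{Y}_n)\ge 1-\epsilon\big)\ge 1-\epsilon;$$ (P2) under $P_{\theta_0}^n$, $T_n$ converges in distribution to some random variable $T$ with continuous CDF; (P3) for every $c\in\mathbb{R}$, $\ \sup_{\theta\in A_n(c),\,t\in\mathbb{R}}|G_n(t\mid\theta)-G_n(t\mid\theta_0)|\to 0$ as $n\to\infty$. Then the posterior predictive $p$-value of $T_n$ is asymptotically well calibrated.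
   Context: For each $n$, $\mathbf{Y}_n\in\mathbb{R}^n$ is a random data vector with realization $\mathbf{y}_n$, modeled as $\mathbf{Y}_n\sim P_\theta^n$ with $\theta\in\Theta\subset\mathbb{R}^k$, where $P_\theta^n$ has a density with respect to Lebesgue measure. The true parameter is $\theta_0$, an interior point of $\Theta$. A prior $\pi$ on $\Theta$ is given, and $\pi(\cdot\mid\mathbf{y}_n)$ denotes the posterior distribution of $\theta$ given $\mathbf{y}_n$. The posterior predictive $p$-value (ppp) of the statistic $T_n$ is $$\mathrm{ppp}(\mathbf{y}_n)=\int_\Theta P_\theta^n\big(T_n(\mathbf{Y}_n)\ge T_n(\mathbf{y}_n)\big)\,\pi(d\theta\mid\mathbf{y}_n),$$ that is, the probability that $T_n$ evaluated at a new data set drawn from the posterior predictive distribution is at least its observed value $T_n(\mathbf{y}_n)$. The ppp is asymptotically well calibrated if its distribution under the null is asymptotically uniform on $[0,1]$, i.e. $\sup_{\alpha\in[0,1]}|P_{\theta_0}^n(\mathrm{ppp}(\mathbf{Y}_n)\le\alpha)-\alpha|\to0$ as $n\to\infty$. *)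

theory Defs
  imports "HOL-Probability.Probability"
begin

text \<open>
  A vector of length \<open>n\<close> is a function in \<open>{..<n} \<rightarrow>\<^sub>E UNIV\<close>, so that \<open>n\<close> may vary inside a
  statement. The argument \<open>f n \<theta> y\<close> below is the density (likelihood) of the \<open>n\<close>-th model at
  parameter \<open>\<theta>\<close> and data \<open>y\<close>. All probabilities are taken on the sample space itself,
  with the data vector being the identity map.
\<close>

definition lebesgue_n :: "nat \<Rightarrow> (nat \<Rightarrow> real) measure" where
  "lebesgue_n n = (\<Pi>\<^sub>M i\<in>{..<n}. lborel)"

definition sampling ::
  "(nat \<Rightarrow> 'p \<Rightarrow> (nat \<Rightarrow> real) \<Rightarrow> ennreal) \<Rightarrow> nat \<Rightarrow> 'p \<Rightarrow> (nat \<Rightarrow> real) measure" where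
  "sampling f n \<theta> = density (lebesgue_n n) (f n \<theta>)"

text \<open>
  Bayes' formula. Where the marginal density of the data is \<open>0\<close> or \<open>\<infinity>\<close> the formula has no
  meaning; the conventions for division in \<^typ>\<open>ennreal\<close> then make \<open>posterior\<close> the null measure.
\<close>

definition posterior ::
  "(nat \<Rightarrow> 'p \<Rightarrow> (nat \<Rightarrow> real) \<Rightarrow> ennreal) \<Rightarrow> 'p measure \<Rightarrow> nat \<Rightarrow> (nat \<Rightarrow> real) \<Rightarrow> 'p measure" where
  "posterior f prior n y =
     density prior (\<lambda>\<theta>. f n \<theta> y / (\<integral>\<^sup>+ \<theta>'. f n \<theta>' y \<partial>prior))"

definition ppp ::
  "(nat \<Rightarrow> 'p \<Rightarrow> (nat \<Rightarrow> real) \<Rightarrow> ennreal) \<Rightarrow> 'p measure \<Rightarrow> (nat \<Rightarrow> (nat \<Rightarrow> real) \<Rightarrow> real) \<Rightarrow>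
     nat \<Rightarrow> (nat \<Rightarrow> real) \<Rightarrow> real" where
  "ppp f prior T n y =
     (\<integral>\<theta>. measure (sampling f n \<theta>) {y' \<in> space (sampling f n \<theta>). T n y' \<ge> T n y}
        \<partial>(posterior f prior n y))"

definition stat_cdf ::
  "(nat \<Rightarrow> 'p \<Rightarrow> (nat \<Rightarrow> real) \<Rightarrow> ennreal) \<Rightarrow> (nat \<Rightarrow> (nat \<Rightarrow> real) \<Rightarrow> real) \<Rightarrow>
     nat \<Rightarrow> real \<Rightarrow> 'p \<Rightarrow> real" where
  "stat_cdf f T n t \<theta> = measure (sampling f n \<theta>) {y \<in> space (sampling f n \<theta>). T n y \<le> t}"

definition shrinking_nbhd ::
  "'p::real_normed_vector set \<Rightarrow> 'p \<Rightarrow> nat \<Rightarrow> real \<Rightarrow> 'p set" where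
  "shrinking_nbhd \<Theta> \<theta>0 n c = {\<theta> \<in> \<Theta>. norm (\<theta> - \<theta>0) \<le> c / sqrt (real n)}"

definition asymp_well_calibrated ::
  "(nat \<Rightarrow> 'y measure) \<Rightarrow> (nat \<Rightarrow> 'y \<Rightarrow> real) \<Rightarrow> bool" where
  "asymp_well_calibrated P p \<longleftrightarrow>
     (\<lambda>n. SUP \<alpha>\<in>{0..1}. \<bar>measure (P n) {y \<in> space (P n). p n y \<le> \<alpha>} - \<alpha>\<bar>) \<longlonglongrightarrow> 0"

end

theory Submission
  imports Defs
begin

text \<open>
  By Polya's theorem the distribution functions of \<open>T\<^sub>n\<close> under \<open>\<theta>\<^sub>0\<close> converge uniformly to the
  continuous limit \<open>F\<close>, and by (P3) so do those under every \<open>\<theta> \<in> A\<^sub>n(c)\<close>. The tail probabilities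
  \<open>P\<^sub>\<theta>(T\<^sub>n \<ge> t)\<close> are then uniformly close to \<open>1 - F t\<close>, since left limits of the distribution
  functions are controlled by continuity of \<open>F\<close>. On the event of (P1) the posterior puts nearly all
  its mass on \<open>A\<^sub>n(c)\<close>, so the predictive p-value is close to \<open>1 - F(T\<^sub>n)\<close>, which is nearly uniform.
\<close>

section \<open>Uniform convergence of distribution functions\<close>

lemma (in real_distribution) cdf_continuous_attains:
  assumes cont: "continuous_on UNIV (cdf M)" and p: "0 < p" "p < 1"
  obtains x where "cdf M x = p"
proof -
  have "eventually (\<lambda>x. cdf M x < p) at_bot"
    using cdf_lim_at_bot p(1) by (rule order_tendstoD(2))
  then obtain a where a: "cdf M a < p"
    by (metis eventually_at_bot_linorder order_refl)
  have "eventually (\<lambda>x. p < cdf M x) at_top"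
    using cdf_lim_at_top_prob p(2) by (rule order_tendstoD(1))
  then obtain b where b: "p < cdf M b"
    by (metis eventually_at_top_linorder order_refl)
  have "a \<le> b"
    using a b cdf_nondecreasing[of b a] by linarith
  then obtain x where "cdf M x = p"
    using IVT'[of "cdf M" a p b] a b continuous_on_subset[OF cont] by auto
  then show ?thesis by (rule that)
qed

text \<open>Polya's argument: continuity supplies points where \<open>cdf M\<close> equals
  \<open>k / m\<close>, pointwise convergence at these finitely many points is simultaneous, and
  monotonicity controls everything between them. The conditions on \<open>F n\<close> are eventual
  because the models are constrained only for \<open>n \<ge> 1\<close>.\<close>

lemma (in real_distribution) weak_conv_uniform_limit:
  fixes F :: "nat \<Rightarrow> real \<Rightarrow> real"
  assumes cont: "continuous_on UNIV (cdf M)"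
    and lim: "weak_conv F (cdf M)"
    and F: "\<forall>\<^sub>F n in sequentially. mono (F n) \<and> range (F n) \<subseteq> {0..1}"
  shows "uniform_limit UNIV F (cdf M) sequentially"
proof (rule uniform_limitI)
  fix e :: real
  assume "e > 0"
  \<comment> \<open>The lower estimate below loses three cells of width \<open>1 / m\<close>: one
    for the position of \<open>t\<close> inside its cell, one for stepping back to index
    \<open>j - 1\<close>, one for the error at the grid point.\<close>
  then obtain m :: nat where m: "3 / e < real m"
    using reals_Archimedean2 by blast
  have "0 < 3 / e" using \<open>e > 0\<close> by simp
  then have m_pos: "0 < real m" using m by linarith
  have m_e: "3 / m < e"
    using m m_pos \<open>e > 0\<close> by (simp add: field_simps)
  have "\<forall>k\<in>{1..<m}. \<exists>x. cdf M x = k / m"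
  proof
    fix k assume "k \<in> {1..<m}"
    then have "0 < real k / m" "real k / m < 1" by auto
    then show "\<exists>x. cdf M x = k / m"
      using cdf_continuous_attains[OF cont] by metis
  qed
  then obtain x where x: "\<And>k. k \<in> {1..<m} \<Longrightarrow> cdf M (x k) = k / m"
    by metis
  have "\<forall>\<^sub>F n in sequentially. \<forall>k\<in>{1..<m}. dist (F n (x k)) (cdf M (x k)) < 1 / m"
  proof (rule eventually_ball_finite)
    show "\<forall>k\<in>{1..<m}. \<forall>\<^sub>F n in sequentially. dist (F n (x k)) (cdf M (x k)) < 1 / m"
    proof
      fix k
      have "(\<lambda>n. F n (x k)) \<longlonglongrightarrow> cdf M (x k)"
        using lim cont by (simp add: weak_conv_def continuous_on_eq_continuous_at)
      then show "\<forall>\<^sub>F n in sequentially. dist (F n (x k)) (cdf M (x k)) < 1 / m"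
        using m_pos by (intro tendstoD) auto
    qed
  qed simp
  with F show "\<forall>\<^sub>F n in sequentially. \<forall>t\<in>UNIV. dist (F n t) (cdf M t) < e"
  proof eventually_elim
    case (elim n)
    have mono: "F n s \<le> F n t" if "s \<le> t" for s t
      using elim that by (auto dest: monoD)
    have range: "0 \<le> F n t" "F n t \<le> 1" for t
      using elim(1) by (auto simp: image_subset_iff)
    have grid: "\<bar>F n (x k) - k / m\<bar> < 1 / m" if "k \<in> {1..<m}" for k
      using elim(2) x that by (auto simp: dist_real_def)
    show ?case
    proof
      fix t
      \<comment> \<open>\<open>j\<close> is the cell of \<open>t\<close>: \<open>cdf M t\<close>
        lies in \<open>[j / m, (j + 1) / m)\<close>. If \<open>j + 1\<close> is no longer a grid
        index, \<open>cdf M t\<close> is at least \<open>1 - 1 / m\<close> and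
        \<open>F n t \<le> 1\<close> suffices.\<close>
      define j where "j = nat \<lfloor>m * cdf M t\<rfloor>"
      have "0 \<le> m * cdf M t" using cdf_nonneg by simp
      then have "real j \<le> m * cdf M t" "m * cdf M t < real j + 1"
        unfolding j_def by linarith+
      then have j: "real j / m \<le> cdf M t" "cdf M t < (real j + 1) / m"
        using m_pos by (simp_all add: field_simps)
      have "F n t < cdf M t + 3 / m"
      proof (cases "Suc j < m")
        case True
        have "\<not> x (Suc j) \<le> t"
        proof
          assume "x (Suc j) \<le> t"
          then have "cdf M (x (Suc j)) \<le> cdf M t" by (rule cdf_nondecreasing)
          then show False using x[of "Suc j"] True j(2) by (simp add: add_ac)
        qed
        then have "F n t \<le> F n (x (Suc j))" by (intro mono) auto
        also have "\<dots> < (real j + 1) / m + 1 / m"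
          using grid[of "Suc j"] True by (simp add: abs_less_iff add_ac)
        finally show ?thesis using j m_pos by (simp add: field_simps)
      next
        case False
        then have "real m \<le> real j + 1" by linarith
        then have "1 \<le> (real j + 1) / m" using m_pos by (simp add: field_simps)
        then have "1 \<le> real j / m + 1 / m" by (simp add: add_divide_distrib)
        moreover have "0 < 2 / real m" using m_pos by simp
        moreover have "3 / real m = 1 / m + 2 / m" by (simp flip: add_divide_distrib)
        ultimately show ?thesis using j range(2)[of t] by linarith
      qed
      moreover have "cdf M t - 3 / m < F n t"
      \<comment> \<open>Index \<open>j\<close> itself may equal \<open>m\<close>, when
        \<open>cdf M t = 1\<close>, and then has no grid point; \<open>j - 1\<close> always has one
        once \<open>2 \<le> j\<close>. For smaller \<open>j\<close>, \<open>cdf M t < 2 / m\<close>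
        and \<open>0 \<le> F n t\<close> suffices.\<close>
      proof (cases "2 \<le> j")
        case True
        have "real j \<le> m"
        proof -
          have "real j / m \<le> 1" using j(1) cdf_bounded_prob[of t] by linarith
          then show ?thesis using m_pos by (simp add: field_simps)
        qed
        then have k: "j - 1 \<in> {1..<m}" using True by auto
        have "\<not> t \<le> x (j - 1)"
        proof
          assume "t \<le> x (j - 1)"
          then have "cdf M t \<le> cdf M (x (j - 1))" by (rule cdf_nondecreasing)
          then have "real j / m \<le> (real j - 1) / m" 
            using x[OF k] j(1) True by (simp add: of_nat_diff)
          then show False using m_pos by (simp add: field_simps)
        qed
        then have "F n (x (j - 1)) \<le> F n t" by (intro mono) auto
        moreover have "(real j - 1) / m - 1 / m < F n (x (j - 1))"
          using grid[OF k] True by (simp add: abs_less_iff of_nat_diff)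
        moreover have "(real j - 1) / m - 1 / m = (real j + 1) / m - 3 / m"
          by (simp flip: diff_divide_distrib)
        ultimately show ?thesis using j(2) by linarith
      next
        case False
        then have "(real j + 1) / m \<le> 3 / m"
          using m_pos by (intro divide_right_mono) auto
        then show ?thesis using j(2) range(1)[of t] by linarith
      qed
      ultimately show "dist (F n t) (cdf M t) < e"
        using m_e by (auto simp: dist_real_def abs_less_iff)
    qed
  qed
qed

section \<open>Averages under a measure concentrated on a set\<close>

text \<open>On \<open>A\<close> the integrand is within \<open>d\<close> of \<open>v\<close>; the
  rest has mass at most \<open>\<epsilon>\<close> and values in the unit interval. The total mass is
  only bounded by 1, since a posterior may be the null measure.\<close>

lemma (in finite_measure) integral_near_const:
  fixes h :: "'a \<Rightarrow> real"
  assumes h: "h \<in> borel_measurable M" "\<And>x. x \<in> space M \<Longrightarrow> 0 \<le> h x \<and> h x \<le> 1"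
    and total: "measure M (space M) \<le> 1"
    and A: "A \<in> sets M" "1 - \<epsilon> \<le> measure M A"
    and near: "\<And>x. x \<in> A \<Longrightarrow> \<bar>h x - v\<bar> \<le> d"
    and v: "0 \<le> v" "v \<le> 1" and d: "0 \<le> d"
  shows "\<bar>(\<integral>x. h x \<partial>M) - v\<bar> \<le> d + \<epsilon>"
proof -
  have h_int: "integrable M h"
    using h by (intro integrable_const_bound[where B = 1]) auto
  have ind_int: "integrable M (indicat_real B)" if "B \<in> sets M" for B
    using that by (intro integrable_real_indicator) (auto simp: less_top[symmetric])
  have a: "measure M A \<le> 1" using bounded_measure[of A] total by linarith
  have sub: "A \<subseteq> space M" using A(1) by (rule sets.sets_into_space)
  have "(v - d) * measure M A = (\<integral>x. (v - d) * indicator A x \<partial>M)"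
    using sub by (simp add: Int_absorb2)
  also have "\<dots> \<le> (\<integral>x. h x \<partial>M)"
  proof (rule integral_mono[OF _ h_int])
    fix x assume "x \<in> space M"
    then show "(v - d) * indicator A x \<le> h x"
      using h(2)[of x] near[of x] by (auto simp: indicator_def abs_le_iff)
  qed (use A(1) ind_int in auto)
  finally have lower: "(v - d) * measure M A \<le> (\<integral>x. h x \<partial>M)" .
  have "(\<integral>x. h x \<partial>M) \<le> (\<integral>x. (v + d) * indicator A x + indicator (space M - A) x \<partial>M)"
  proof (rule integral_mono[OF h_int])
    fix x assume "x \<in> space M"
    then show "h x \<le> (v + d) * indicator A x + indicator (space M - A) x"
      using h(2)[of x] near[of x] by (auto simp: indicator_def abs_le_iff)
  qed (use A(1) ind_int in auto)
  also have "\<dots> = (v + d) * measure M A + measure M (space M - A)"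
    using sub A(1) ind_int by (subst Bochner_Integration.integral_add)
      (auto simp: Int_absorb1 Int_absorb2)
  also have "\<dots> = (v + d) * measure M A + (measure M (space M) - measure M A)"
    using A(1) by (simp add: finite_measure_compl)
  also have "\<dots> \<le> v + d + \<epsilon>"
    using mult_left_le[OF a, of "v + d"] v d total A(2) by auto
  finally have upper: "(\<integral>x. h x \<partial>M) \<le> v + d + \<epsilon>" .
  \<comment> \<open>For \<open>v - d \<ge> 0\<close> the missing mass costs at most
    \<open>1 - measure M A \<le> \<epsilon>\<close>, as \<open>v - d \<le> 1\<close>. For
    \<open>v - d < 0\<close> a mass below 1 only raises the product.\<close>
  have "v - d - \<epsilon> \<le> (v - d) * measure M A"
  proof (cases "0 \<le> v - d")
    case True
    have "(v - d) * (1 - measure M A) \<le> 1 * (1 - measure M A)"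
      using v d a by (intro mult_right_mono) auto
    then show ?thesis using A(2) by (simp add: algebra_simps)
  next
    case False
    then have "(v - d) * 1 \<le> (v - d) * measure M A"
      using a by (intro mult_left_mono_neg) auto
    then show ?thesis using A(2) a by simp
  qed
  with lower upper show ?thesis by (simp add: abs_le_iff)
qed

section \<open>Basic properties of the sampling and posterior measures\<close>

lemma sigma_finite_lebesgue_n: "sigma_finite_measure (lebesgue_n n)"
proof -
  interpret product_sigma_finite "\<lambda>_::nat. lborel :: real measure"
    by unfold_locales
  show ?thesis
    unfolding lebesgue_n_def by (rule sigma_finite) simp
qed

lemma space_sampling [simp]: "space (sampling f n \<theta>) = space (lebesgue_n n)"
  by (simp add: sampling_def)

lemma sets_sampling [simp, measurable_cong]: "sets (sampling f n \<theta>) = sets (lebesgue_n n)"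
  by (simp add: sampling_def)

lemma space_posterior [simp]: "space (posterior f prior n y) = space prior"
  by (simp add: posterior_def)

lemma sets_posterior [simp, measurable_cong]: "sets (posterior f prior n y) = sets prior"
  by (simp add: posterior_def)

text \<open>The total mass is the marginal density divided by itself: 1 in the regular case, and 0
  when the marginal is 0 or infinite, because both quotients are 0 in
  \<open>ennreal\<close>.\<close>

lemma emeasure_posterior_space_le:
  assumes "(\<lambda>\<theta>. f n \<theta> y) \<in> borel_measurable prior"
  shows "emeasure (posterior f prior n y) (space prior) \<le> 1"
proof -
  let ?m = "\<integral>\<^sup>+ \<theta>. f n \<theta> y \<partial>prior"
  have "emeasure (posterior f prior n y) (space prior) = (\<integral>\<^sup>+ \<theta>. f n \<theta> y / ?m \<partial>prior)"
    using assms unfolding posterior_def by (subst emeasure_density) (auto intro: nn_integral_cong)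
  also have "\<dots> = ?m / ?m"
    using assms by (rule nn_integral_divide)
  also have "\<dots> \<le> 1"
    by (cases "?m = 0 \<or> ?m = \<top>") (auto simp: ennreal_divide_self less_top)
  finally show ?thesis .
qed

lemma finite_measure_posterior:
  assumes "(\<lambda>\<theta>. f n \<theta> y) \<in> borel_measurable prior"
  shows "finite_measure (posterior f prior n y)"
proof
  show "emeasure (posterior f prior n y) (space (posterior f prior n y)) \<noteq> \<infinity>"
    using emeasure_posterior_space_le[of f n y prior, OF assms] by (auto simp: top_unique)
qed

section \<open>Measurability of tail probabilities and of the p-value\<close>

text \<open>The integrand of \<open>ppp\<close> with the observed value replaced by a free threshold
  \<open>t\<close>, so that joint measurability in \<open>(\<theta>, t)\<close> can be proved first
  and \<open>t = T n y\<close> substituted afterwards.\<close>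

definition tail_prob ::
  "(nat \<Rightarrow> 'p \<Rightarrow> (nat \<Rightarrow> real) \<Rightarrow> ennreal) \<Rightarrow> (nat \<Rightarrow> (nat \<Rightarrow> real) \<Rightarrow> real) \<Rightarrow>
     nat \<Rightarrow> real \<Rightarrow> 'p \<Rightarrow> real" where
  "tail_prob f T n t \<theta> = measure (sampling f n \<theta>) {y \<in> space (sampling f n \<theta>). T n y \<ge> t}"

text \<open>By Tonelli: the tail probability integrates over \<open>y\<close> a jointly measurable
  function of \<open>(\<theta>, t)\<close> and \<open>y\<close>, against a sigma-finite
  measure.\<close>

lemma borel_measurable_tail_prob:
  assumes f: "(\<lambda>(\<theta>, y). f n \<theta> y) \<in> borel_measurable (M \<Otimes>\<^sub>M lebesgue_n n)"
    and T [measurable]: "T n \<in> borel_measurable (lebesgue_n n)"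
  shows "(\<lambda>(\<theta>, t). tail_prob f T n t \<theta>) \<in> borel_measurable (M \<Otimes>\<^sub>M borel)"
proof -
  interpret L: sigma_finite_measure "lebesgue_n n" by (rule sigma_finite_lebesgue_n)
  note f [measurable]
  have "(\<lambda>p. enn2real (\<integral>\<^sup>+ y. f n (fst p) y * indicator {y. snd p \<le> T n y} y \<partial>lebesgue_n n))
      \<in> borel_measurable (M \<Otimes>\<^sub>M borel)"
    by measurable
  also have "?this \<longleftrightarrow> ?thesis"
  proof (rule measurable_cong)
    fix p assume "p \<in> space (M \<Otimes>\<^sub>M borel :: ('a \<times> real) measure)"
    then have "fst p \<in> space M" by (auto simp: space_pair_measure)
    then have [measurable]: "f n (fst p) \<in> borel_measurable (lebesgue_n n)"
      using measurable_Pair2[OF f] by simp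
    show "enn2real (\<integral>\<^sup>+ y. f n (fst p) y * indicator {y. snd p \<le> T n y} y \<partial>lebesgue_n n) =
      (case p of (\<theta>, t) \<Rightarrow> tail_prob f T n t \<theta>)"
      unfolding tail_prob_def measure_def case_prod_beta space_sampling
      unfolding sampling_def
      by (subst emeasure_density)
        (auto intro!: arg_cong[where f = enn2real] nn_integral_cong simp: indicator_def)
  qed
  finally show ?thesis .
qed

text \<open>Makes the events \<open>ppp \<le> \<alpha>\<close> measurable. Unfolding the posterior
  density turns \<open>ppp\<close> into a parametric integral over the prior, so Tonelli applies to
  it and to the normalising integral inside.\<close>

lemma borel_measurable_ppp:
  assumes prior: "sigma_finite_measure prior"
    and f: "(\<lambda>(\<theta>, y). f n \<theta> y) \<in> borel_measurable (prior \<Otimes>\<^sub>M lebesgue_n n)"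
    and T [measurable]: "T n \<in> borel_measurable (lebesgue_n n)"
  shows "ppp f prior T n \<in> borel_measurable (lebesgue_n n)"
proof -
  interpret sigma_finite_measure prior by fact
  note f [measurable] borel_measurable_tail_prob[where f = f and T = T and n = n, OF f T, measurable]
  have "(\<lambda>y. enn2real (\<integral>\<^sup>+ \<theta>. f n \<theta> y / (\<integral>\<^sup>+ \<theta>'. f n \<theta>' y \<partial>prior) *
      ennreal (tail_prob f T n (T n y) \<theta>) \<partial>prior)) \<in> borel_measurable (lebesgue_n n)"
    by measurable
  also have "?this \<longleftrightarrow> ?thesis"
  proof (rule measurable_cong)
    fix y assume y: "y \<in> space (lebesgue_n n)"
    have [measurable]: "(\<lambda>\<theta>. f n \<theta> y) \<in> borel_measurable prior"
      using measurable_Pair1[OF f y] by simp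
    have [measurable]: "(\<lambda>\<theta>. tail_prob f T n (T n y) \<theta>) \<in> borel_measurable prior"
      using measurable_Pair1[OF borel_measurable_tail_prob[where f = f and T = T and n = n, OF f T], of "T n y"] by simp
    have "ppp f prior T n y = (\<integral>\<theta>. tail_prob f T n (T n y) \<theta> \<partial>posterior f prior n y)"
      by (simp add: ppp_def tail_prob_def)
    also have "\<dots> = enn2real (\<integral>\<^sup>+ \<theta>. ennreal (tail_prob f T n (T n y) \<theta>) \<partial>posterior f prior n y)"
    proof (rule integral_eq_nn_integral)
      show "(\<lambda>\<theta>. tail_prob f T n (T n y) \<theta>) \<in> borel_measurable (posterior f prior n y)"
        by measurable
    qed (simp add: tail_prob_def)
    also have "\<dots> = enn2real (\<integral>\<^sup>+ \<theta>. f n \<theta> y / (\<integral>\<^sup>+ \<theta>'. f n \<theta>' y \<partial>prior) *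
      ennreal (tail_prob f T n (T n y) \<theta>) \<partial>prior)"
      unfolding posterior_def by (subst nn_integral_density) auto
    finally show "enn2real (\<integral>\<^sup>+ \<theta>. f n \<theta> y / (\<integral>\<^sup>+ \<theta>'. f n \<theta>' y \<partial>prior) *
      ennreal (tail_prob f T n (T n y) \<theta>) \<partial>prior) = ppp f prior T n y" ..
  qed
  finally show ?thesis .
qed

section \<open>Tail probabilities and near-uniformity for a single model\<close>

text \<open>The complementary probability of \<open>T < t\<close> lies between the distribution
  function at any \<open>s < t\<close> and at \<open>t\<close>. Letting \<open>s\<close> increase to
  \<open>t\<close>, continuity of \<open>F\<close> keeps the same error \<open>d\<close>, even if
  the law of \<open>T\<close> has atoms.\<close>

lemma tail_prob_near:
  assumes P: "prob_space (sampling f n \<theta>)"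
    and T [measurable]: "T n \<in> borel_measurable (lebesgue_n n)"
    and F: "continuous_on UNIV F"
    and near: "\<And>s. \<bar>stat_cdf f T n s \<theta> - F s\<bar> \<le> d"
  shows "\<bar>tail_prob f T n t \<theta> - (1 - F t)\<bar> \<le> d"
proof -
  interpret prob_space "sampling f n \<theta>" by fact
  let ?L = "prob {y \<in> space (lebesgue_n n). T n y < t}"
  have "{y \<in> space (lebesgue_n n). T n y \<ge> t} =
      space (sampling f n \<theta>) - {y \<in> space (lebesgue_n n). T n y < t}"
    by auto
  then have tail: "tail_prob f T n t \<theta> = 1 - ?L"
    unfolding tail_prob_def space_sampling
    using prob_compl[of "{y \<in> space (lebesgue_n n). T n y < t}"] by simp
  have "?L \<le> stat_cdf f T n t \<theta>"
    unfolding stat_cdf_def space_sampling by (intro finite_measure_mono) auto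
  then have upper: "?L \<le> F t + d"
    using near[of t] by (simp add: abs_le_iff)
  have "F s - d \<le> ?L" if "s < t" for s
  proof -
    have "stat_cdf f T n s \<theta> \<le> ?L"
      unfolding stat_cdf_def space_sampling using that by (intro finite_measure_mono) auto
    then show ?thesis using near[of s] by (simp add: abs_le_iff)
  qed
  then have ev: "\<forall>\<^sub>F s in at_left t. F s - d \<le> ?L"
    by (simp add: eventually_at_filter)
  have "(F \<longlongrightarrow> F t) (at t)"
    using F by (simp add: continuous_on_eq_continuous_at isCont_def)
  then have "(F \<longlongrightarrow> F t) (at_left t)"
    by (rule filterlim_mono) (auto simp: at_le)
  then have "((\<lambda>s. F s - d) \<longlongrightarrow> F t - d) (at_left t)"
    by (intro tendsto_intros)
  then have "F t - d \<le> ?L"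
    using ev by (rule tendsto_upperbound) simp
  with tail upper show ?thesis by (simp add: abs_le_iff)
qed

text \<open>
  The event \<open>p \<le> \<alpha>\<close> is compared with events \<open>T > x\<close>, where the continuous \<open>cdf \<mu>\<close> takes a
  value near \<open>1 - \<alpha>\<close> at \<open>x\<close>.
\<close>

lemma (in prob_space) p_value_near_uniform:
  fixes p T :: "'a \<Rightarrow> real"
  assumes \<mu>: "real_distribution \<mu>" "continuous_on UNIV (cdf \<mu>)"
    and p [measurable]: "p \<in> borel_measurable M"
    and T [measurable]: "T \<in> borel_measurable M"
    and cdf_T: "\<And>t. \<bar>prob {y \<in> space M. T y \<le> t} - cdf \<mu> t\<bar> \<le> \<delta>"
    and E: "E \<in> events" "1 - \<epsilon> \<le> prob E"
    and near: "\<And>y. y \<in> E \<Longrightarrow> \<bar>p y - (1 - cdf \<mu> (T y))\<bar> \<le> \<eta>"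
    and pos: "0 \<le> \<delta>" "0 \<le> \<epsilon>" "0 < \<eta>" and \<alpha>: "0 \<le> \<alpha>" "\<alpha> \<le> 1"
  shows "\<bar>prob {y \<in> space M. p y \<le> \<alpha>} - \<alpha>\<bar> \<le> \<delta> + \<epsilon> + 2 * \<eta>"
proof -
  interpret \<mu>: real_distribution \<mu> by fact
  let ?S = "{y \<in> space M. p y \<le> \<alpha>}"
  have sub: "E \<subseteq> space M" using E(1) by (rule sets.sets_into_space)
  have compl_E: "prob (space M - E) \<le> \<epsilon>" using E by (simp add: prob_compl)
  have tail: "\<bar>prob {y \<in> space M. x < T y} - (1 - cdf \<mu> x)\<bar> \<le> \<delta>" for x
  proof -
    have "{y \<in> space M. x < T y} = space M - {y \<in> space M. T y \<le> x}" by auto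
    then have "prob {y \<in> space M. x < T y} = 1 - prob {y \<in> space M. T y \<le> x}"
      by (simp add: prob_compl)
    then show ?thesis using cdf_T[of x] by linarith
  qed
  \<comment> \<open>Inclusions between events are available only on \<open>E\<close>; leaving
    \<open>E\<close> costs at most \<open>\<epsilon>\<close>.\<close>
  have union_bound: "prob A \<le> prob B + \<epsilon>"
    if "A \<inter> E \<subseteq> B" "A \<in> events" "B \<in> events" for A B
  proof -
    have "A \<subseteq> B \<union> (space M - E)"
      using that(1) sets.sets_into_space[OF that(2)] by blast
    then have "prob A \<le> prob (B \<union> (space M - E))"
      using that E(1) by (intro finite_measure_mono) auto
    also have "\<dots> \<le> prob B + prob (space M - E)"
      using that E(1) by (intro measure_Un_le) auto
    finally show ?thesis using compl_E by linarith
  qed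
  have "prob ?S \<le> \<alpha> + \<delta> + \<epsilon> + 2 * \<eta>"
  \<comment> \<open>On \<open>E\<close>, \<open>p y \<le> \<alpha>\<close> gives
    \<open>cdf \<mu> (T y) \<ge> 1 - \<alpha> - \<eta>\<close>. The second \<open>\<eta>\<close> in
    the level of \<open>x\<close> makes the comparison strict, which forces \<open>x < T y\<close>.
    If no such level is positive, the bound is at least 1.\<close>
  proof (cases "\<alpha> + 2 * \<eta> < 1")
    case True
    then obtain x where x: "cdf \<mu> x = 1 - \<alpha> - 2 * \<eta>"
      using \<mu>.cdf_continuous_attains[OF \<mu>(2), of "1 - \<alpha> - 2 * \<eta>"] \<alpha> pos by auto
    have "?S \<inter> E \<subseteq> {y \<in> space M. x < T y}"
    proof
      fix y assume y: "y \<in> ?S \<inter> E"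
      then have "cdf \<mu> x < cdf \<mu> (T y)" using near[of y] x pos by auto
      then have "\<not> T y \<le> x" using \<mu>.cdf_nondecreasing[of "T y" x] by linarith
      then show "y \<in> {y \<in> space M. x < T y}" using y by auto
    qed
    then have "prob ?S \<le> prob {y \<in> space M. x < T y} + \<epsilon>"
      by (rule union_bound) auto
    then show ?thesis using tail[of x] x by linarith
  next
    case False
    then show ?thesis using prob_le_1[of ?S] pos by linarith
  qed
  moreover have "\<alpha> - \<delta> - \<epsilon> - 2 * \<eta> \<le> prob ?S"
  \<comment> \<open>Here a weak inequality is enough, so one \<open>\<eta>\<close> suffices:
    \<open>x < T y\<close> gives \<open>1 - cdf \<mu> (T y) \<le> \<alpha> - \<eta>\<close>, hence
    \<open>p y \<le> \<alpha>\<close> on \<open>E\<close>. For \<open>\<alpha> \<le> \<eta>\<close>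
    the lower bound is not positive.\<close>
  proof (cases "\<eta> < \<alpha>")
    case True
    then obtain x where x: "cdf \<mu> x = 1 - \<alpha> + \<eta>"
      using \<mu>.cdf_continuous_attains[OF \<mu>(2), of "1 - \<alpha> + \<eta>"] \<alpha> pos by auto
    have "{y \<in> space M. x < T y} \<inter> E \<subseteq> ?S"
    proof
      fix y assume y: "y \<in> {y \<in> space M. x < T y} \<inter> E"
      then have "cdf \<mu> x \<le> cdf \<mu> (T y)" by (intro \<mu>.cdf_nondecreasing) auto
      then show "y \<in> ?S" using near[of y] x y by (auto simp: abs_le_iff)
    qed
    then have "prob {y \<in> space M. x < T y} \<le> prob ?S + \<epsilon>"
      by (rule union_bound) auto
    then show ?thesis using tail[of x] x pos by linarith
  next
    case False
    then show ?thesis using measure_nonneg[of M ?S] pos by linarith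
  qed
  ultimately show ?thesis by (simp add: abs_le_iff)
qed


section \<open>Calibration along the sequence of models\<close>

theorem proposition1:
  fixes \<Theta> :: "(real ^ 'k) set"
    and \<theta>0 :: "real ^ 'k"
    and prior :: "(real ^ 'k) measure"
    and f :: "nat \<Rightarrow> real ^ 'k \<Rightarrow> (nat \<Rightarrow> real) \<Rightarrow> ennreal"
    and T :: "nat \<Rightarrow> (nat \<Rightarrow> real) \<Rightarrow> real"
    and \<mu> :: "real measure"
  assumes Theta: "\<Theta> \<in> sets borel" "\<theta>0 \<in> interior \<Theta>"
    and prior: "prob_space prior" "sets prior = sets (restrict_space borel \<Theta>)"
    and density: "\<And>n. n \<ge> 1 \<Longrightarrow>
          (\<lambda>(\<theta>, y). f n \<theta> y) \<in> borel_measurable (restrict_space borel \<Theta> \<Otimes>\<^sub>M lebesgue_n n)"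
        "\<And>n \<theta>. n \<ge> 1 \<Longrightarrow> \<theta> \<in> \<Theta> \<Longrightarrow> prob_space (sampling f n \<theta>)"
    and statistic: "\<And>n. n \<ge> 1 \<Longrightarrow> T n \<in> borel_measurable (lebesgue_n n)"
    and P1: "\<And>\<epsilon>::real. \<epsilon> > 0 \<Longrightarrow> \<exists>c::real. \<exists>N::nat. N > 0 \<and> (\<forall>n>N.
          measure (sampling f n \<theta>0)
            {y \<in> space (sampling f n \<theta>0).
               measure (posterior f prior n y) (shrinking_nbhd \<Theta> \<theta>0 n c) \<ge> 1 - \<epsilon>}
          \<ge> 1 - \<epsilon>)"
    and P2: "real_distribution \<mu>" "continuous_on UNIV (cdf \<mu>)"
        "weak_conv_m (\<lambda>n. distr (sampling f n \<theta>0) borel (T n)) \<mu>"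
    and P3: "\<And>c::real. (\<lambda>n. SUP (\<theta>, t) \<in> shrinking_nbhd \<Theta> \<theta>0 n c \<times> UNIV.
          ennreal \<bar>stat_cdf f T n t \<theta> - stat_cdf f T n t \<theta>0\<bar>) \<longlonglongrightarrow> 0"
  shows "asymp_well_calibrated (\<lambda>n. sampling f n \<theta>0) (ppp f prior T)"
  unfolding asymp_well_calibrated_def
proof (rule LIMSEQ_I)
  fix r :: real
  assume "r > 0"
  interpret \<mu>: real_distribution \<mu> by fact
  interpret prior: prob_space prior by fact
  \<comment> \<open>The final error is \<open>8 * e\<close>, which \<open>r / 10\<close> keeps below
    \<open>r\<close>. The cap \<open>1 / 2\<close> keeps \<open>1 - e\<close> positive, which later
    yields measurability of the concentration event.\<close>
  define e where "e = min (r / 10) (1 / 2)"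
  have e: "0 < e" "e < 1" "8 * e < r"
    using \<open>r > 0\<close> by (auto simp: e_def)
  have \<theta>0: "\<theta>0 \<in> \<Theta>" using Theta(2) interior_subset by blast
  have space_prior: "space prior = \<Theta>"
    using sets_eq_imp_space_eq[OF prior(2)] by (simp add: space_restrict_space)
  have f: "(\<lambda>(\<theta>, y). f n \<theta> y) \<in> borel_measurable (prior \<Otimes>\<^sub>M lebesgue_n n)" if "n \<ge> 1" for n
    using density(1)[OF that] measurable_cong_sets[OF sets_pair_measure_cong[OF prior(2) refl] refl]
    by blast
  obtain c N where cN: "\<And>n. n > N \<Longrightarrow> 1 - e \<le> measure (sampling f n \<theta>0)
      {y \<in> space (sampling f n \<theta>0).
         1 - e \<le> measure (posterior f prior n y) (shrinking_nbhd \<Theta> \<theta>0 n c)}"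
    using P1[OF e(1)] by blast
  let ?F = "\<lambda>n t. stat_cdf f T n t \<theta>0"
  have cdf_eq: "cdf (distr (sampling f n \<theta>0) borel (T n)) t = ?F n t" if "n \<ge> 1" for n t
    unfolding cdf_def stat_cdf_def using statistic[OF that]
    by (subst measure_distr) (auto simp: vimage_def Int_def conj_commute)
  have "weak_conv ?F (cdf \<mu>)"
    unfolding weak_conv_def
  proof (intro allI impI)
    fix t assume "isCont (cdf \<mu>) t"
    then have "(\<lambda>n. cdf (distr (sampling f n \<theta>0) borel (T n)) t) \<longlonglongrightarrow> cdf \<mu> t"
      using P2(3) by (simp add: weak_conv_m_def weak_conv_def)
    then show "(\<lambda>n. ?F n t) \<longlonglongrightarrow> cdf \<mu> t"
      \<comment> \<open>The two sequences are identified only for \<open>n \<ge> 1\<close>, where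
        \<open>T n\<close> is known to be measurable.\<close>
      by (rule Lim_transform_eventually)
        (use cdf_eq in \<open>auto intro: eventually_sequentiallyI[of 1]\<close>)
  qed
  moreover have "\<forall>\<^sub>F n in sequentially. mono (?F n) \<and> range (?F n) \<subseteq> {0..1}"
  proof (rule eventually_sequentiallyI)
    fix n :: nat assume n: "1 \<le> n"
    interpret prob_space "sampling f n \<theta>0" by (rule density(2)[OF n \<theta>0])
    note statistic[OF n, measurable]
    show "mono (?F n) \<and> range (?F n) \<subseteq> {0..1}"
      unfolding stat_cdf_def by (auto intro!: monoI finite_measure_mono)
  qed
  ultimately have "uniform_limit UNIV ?F (cdf \<mu>) sequentially"
    by (rule \<mu>.weak_conv_uniform_limit[OF P2(2)])
  then have ev_F: "\<forall>\<^sub>F n in sequentially. \<forall>t\<in>UNIV. dist (?F n t) (cdf \<mu> t) < e"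
    using e(1) by (rule uniform_limitD)
  \<comment> \<open>(P3) is invoked at the radius \<open>c\<close> that (P1) supplies for accuracy
    \<open>e\<close>.\<close>
  have ev_G: "\<forall>\<^sub>F n in sequentially. (SUP (\<theta>, t) \<in> shrinking_nbhd \<Theta> \<theta>0 n c \<times> UNIV.
      ennreal \<bar>stat_cdf f T n t \<theta> - ?F n t\<bar>) < ennreal e"
    using P3[of c] by (rule order_tendstoD) (simp add: e)
  have "\<forall>\<^sub>F n in sequentially. \<bar>SUP \<alpha>\<in>{0..1}. \<bar>measure (sampling f n \<theta>0)
      {y \<in> space (sampling f n \<theta>0). ppp f prior T n y \<le> \<alpha>} - \<alpha>\<bar>\<bar> < r"
    using ev_F ev_G eventually_gt_at_top[of N] eventually_ge_at_top[of "1::nat"]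
  proof eventually_elim
    case (elim n)
    note n = elim(4)
    interpret P: prob_space "sampling f n \<theta>0" by (rule density(2)[OF n \<theta>0])
    let ?A = "shrinking_nbhd \<Theta> \<theta>0 n c"
    let ?E = "{y \<in> space (sampling f n \<theta>0). 1 - e \<le> measure (posterior f prior n y) ?A}"
    have A_eq: "?A = cball \<theta>0 (c / sqrt (real n)) \<inter> \<Theta>"
      by (auto simp: shrinking_nbhd_def dist_norm norm_minus_commute)
    then have A: "?A \<in> sets prior" "?A \<subseteq> \<Theta>"
      unfolding prior(2) using Theta(1) by (auto simp: sets_restrict_space_iff)
    have E: "1 - e \<le> P.prob ?E" using cN elim(3) by blast
    \<comment> \<open>\<open>measure\<close> is 0 on non-measurable sets, so the positive lower
      bound from (P1) already forces \<open>?E\<close> to be an event.\<close>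
    then have E_sets: "?E \<in> P.events"
      using e(2) measure_notin_sets[of ?E "sampling f n \<theta>0"] by linarith
    have F_near: "\<bar>?F n t - cdf \<mu> t\<bar> \<le> e" for t
      using elim(1) by (auto simp: dist_real_def intro: less_imp_le)
    \<comment> \<open>One \<open>e\<close> comes from (P3), the other from the uniform convergence
      at \<open>\<theta>0\<close>.\<close>
    have G_near: "\<bar>stat_cdf f T n t \<theta> - cdf \<mu> t\<bar> \<le> 2 * e" if "\<theta> \<in> ?A" for \<theta> t
    proof -
      have "ennreal \<bar>stat_cdf f T n t \<theta> - ?F n t\<bar> \<le>
          (SUP (\<theta>, t) \<in> ?A \<times> UNIV. ennreal \<bar>stat_cdf f T n t \<theta> - ?F n t\<bar>)"
        using that by (intro SUP_upper2[of "(\<theta>, t)"]) auto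
      also have "\<dots> < ennreal e" by (rule elim(2))
      finally have "\<bar>stat_cdf f T n t \<theta> - ?F n t\<bar> < e"
        by (simp add: ennreal_less_iff)
      then show ?thesis using F_near[of t] by linarith
    qed
    \<comment> \<open>Passing from distribution functions to tails keeps the error
      \<open>2 * e\<close>; posterior mass outside \<open>?A\<close> adds the third
      \<open>e\<close>.\<close>
    have ppp_near: "\<bar>ppp f prior T n y - (1 - cdf \<mu> (T n y))\<bar> \<le> 3 * e" if "y \<in> ?E" for y
    proof -
      have y: "y \<in> space (lebesgue_n n)" using that by simp
      have f_y: "(\<lambda>\<theta>. f n \<theta> y) \<in> borel_measurable prior"
        using measurable_Pair1[OF f[OF n] y] by simp
      interpret Q: finite_measure "posterior f prior n y"
        by (rule finite_measure_posterior) (rule f_y)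
      have "(\<lambda>\<theta>. tail_prob f T n (T n y) \<theta>) \<in> borel_measurable prior"
        using measurable_Pair1[OF borel_measurable_tail_prob[where f = f and T = T and n = n,
            OF f[OF n] statistic[OF n]], of "T n y"]
        by simp
      moreover have "tail_prob f T n t \<theta> \<le> 1" if "\<theta> \<in> \<Theta>" for t \<theta>
        unfolding tail_prob_def using prob_space.prob_le_1[OF density(2)[OF n that]] .
      moreover have "\<bar>tail_prob f T n (T n y) \<theta> - (1 - cdf \<mu> (T n y))\<bar> \<le> 2 * e" if "\<theta> \<in> ?A" for \<theta>
        using density(2)[OF n, of \<theta>] A(2) that statistic[OF n] P2(2) G_near
        by (intro tail_prob_near) auto
      moreover have "measure (posterior f prior n y) (space prior) \<le> 1"
        using emeasure_posterior_space_le[where f = f and n = n and y = y, OF f_y]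
          Q.emeasure_eq_measure
        by simp
      moreover have "0 \<le> tail_prob f T n t \<theta>" for t \<theta> by (simp add: tail_prob_def)
      ultimately have "\<bar>(\<integral>\<theta>. tail_prob f T n (T n y) \<theta> \<partial>posterior f prior n y) -
          (1 - cdf \<mu> (T n y))\<bar> \<le> 2 * e + e"
        using that A(1) e(1) \<mu>.cdf_nonneg \<mu>.cdf_bounded_prob space_prior
        by (intro Q.integral_near_const[where A = ?A]) 
          (auto simp: measurable_cong_sets[OF sets_posterior refl])
      moreover have "ppp f prior T n y = (\<integral>\<theta>. tail_prob f T n (T n y) \<theta> \<partial>posterior f prior n y)"
        by (simp add: ppp_def tail_prob_def)
      ultimately show ?thesis by simp
    qed
    have p_meas: "ppp f prior T n \<in> borel_measurable (sampling f n \<theta>0)"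
      using borel_measurable_ppp[where f = f and T = T and n = n,
          OF prior.sigma_finite_measure_axioms f[OF n] statistic[OF n]]
      by (simp add: measurable_cong_sets[OF sets_sampling refl])
    have T_meas: "T n \<in> borel_measurable (sampling f n \<theta>0)"
      using statistic[OF n] by (simp add: measurable_cong_sets[OF sets_sampling refl])
    have bound: "\<bar>P.prob {y \<in> space (sampling f n \<theta>0). ppp f prior T n y \<le> \<alpha>} - \<alpha>\<bar> \<le> 8 * e"
      if "\<alpha> \<in> {0..1}" for \<alpha>
    proof -
      \<comment> \<open>The near-uniformity bound with \<open>\<delta> = e\<close>,
        \<open>\<epsilon> = e\<close> and \<open>\<eta> = 3 * e\<close>.\<close>
      have "\<bar>P.prob {y \<in> space (sampling f n \<theta>0). ppp f prior T n y \<le> \<alpha>} - \<alpha>\<bar>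
          \<le> e + e + 2 * (3 * e)"
        using F_near that e(1)
        by (intro P.p_value_near_uniform[OF P2(1,2) p_meas T_meas _ E_sets E ppp_near])
          (auto simp: stat_cdf_def)
      then show ?thesis by simp
    qed
    let ?S = "SUP \<alpha>\<in>{0..1}. \<bar>P.prob {y \<in> space (sampling f n \<theta>0). ppp f prior T n y \<le> \<alpha>} - \<alpha>\<bar>"
    have "?S \<le> 8 * e"
      using bound by (intro cSUP_least) auto
    moreover have "0 \<le> ?S"
      using bound by (intro cSUP_upper2[of _ _ 0] bdd_aboveI2[where M = "8 * e"]) auto
    ultimately show ?case using e(3) by simp
  qed
  then show "\<exists>no. \<forall>n\<ge>no. norm ((SUP \<alpha>\<in>{0..1}. \<bar>measure (sampling f n \<theta>0)
      {y \<in> space (sampling f n \<theta>0). ppp f prior T n y \<le> \<alpha>} - \<alpha>\<bar>) - 0) < r"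
    by (simp add: eventually_sequentially)
qed

end
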